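(* Let $K\ge 0$, let $f:\mathbb{N}\to\mathbb{R}$ be $K$-convex, let $p\in[0,1]$, and for each $y\in\mathbb{N}$ let $\omega^y\sim\mathrm{Binomial}(y,p)$. If $\mathbb{E}[|f(y-\omega^y)|]<\infty$ for all $y\in\mathbb{N}$, then the function $y\mapsto\mathbb{E}[f(y-\omega^y)]$ on $\mathbb{N}$ is $K$-convex.
   Context: $\mathbb{N}=\{0,1,2,\dots\}$. A function $f:\mathbb{N}\to\mathbb{R}$ is $K$-convex if for all $x,a,b\in\mathbb{N}$ with $x-b\in\mathbb{N}$, $$b\big(K+f(x+a)-f(x)\big)\ge a\big(f(x)-f(x-b)\big).$$ *)

theory Defs
  imports "HOL-Probability.Probability"
begin

definition K_convex :: "real \<Rightarrow> (nat \<Rightarrow> real) \<Rightarrow> bool" where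
  "K_convex K f \<longleftrightarrow>
     (\<forall>x a b. b \<le> x \<longrightarrow> real b * (K + f (x + a) - f x) \<ge> real a * (f x - f (x - b)))"

end

theory Submission
  imports Defs
begin

text \<open>
  The variable \<open>y - \<omega> y\<close> is the position after \<open>y\<close> steps of the walk on \<open>\<nat>\<close> that starts at \<open>0\<close>
  and moves up by one with probability \<open>q = 1 - p\<close> in each step. If \<open>T\<close> denotes the transition
  operator of this walk, the function in question is therefore \<open>y \<mapsto> (T ^^ y) f 0\<close>
  (\<open>expectation_binomial_failures\<close>). With \<open>z = x - b\<close>, the defining inequality of \<open>K\<close>-convexity for it reads
  \<open>(a + b) * (T ^^ (z + b)) f 0 \<le> a * (T ^^ z) f 0 + b * (K + (T ^^ (z + a + b)) f 0)\<close>.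
  Since \<open>T ^^ z\<close> is linear, monotone and fixes constants, it suffices to prove the case \<open>z = 0\<close>
  from an arbitrary starting point, and by translation from the starting point \<open>0\<close>.

  For the path \<open>X\<close> of the walk from \<open>0\<close>, \<open>K\<close>-convexity bounds \<open>f (X\<^sub>b)\<close> by interpolation between \<open>f 0\<close> and
  \<open>K + f (X\<^bsub>a+b\<^esub>)\<close> with weight \<open>X\<^sub>b / X\<^bsub>a+b\<^esub>\<close> on the latter. The weight is random, but by
  exchangeability of the steps its conditional mean given \<open>X\<^bsub>a+b\<^esub>\<close> is \<open>b / (a + b)\<close>, which is the
  deterministic weight that is wanted. The exchangeability enters as the size-bias identity
  \<open>E (X\<^sub>n F (X\<^sub>n)) = n q E (F (1 + X\<^bsub>n-1\<^esub>))\<close>, which is a commutator relation between \<open>T\<close> and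
  multiplication by the position (\<open>walk_mult_position\<close>).
\<close>

definition walk_step :: "real \<Rightarrow> (nat \<Rightarrow> real) \<Rightarrow> nat \<Rightarrow> real" where
  "walk_step q F x = q * F (Suc x) + (1 - q) * F x"

lemma walk_Suc:
  "(walk_step q ^^ Suc n) F x =
     q * (walk_step q ^^ n) F (Suc x) + (1 - q) * (walk_step q ^^ n) F x"
  by (simp add: walk_step_def)

lemma walk_mono:
  assumes "0 \<le> q" "q \<le> 1" "\<And>x. F x \<le> G x"
  shows "(walk_step q ^^ n) F x \<le> (walk_step q ^^ n) G x"
  using assms(3)
  by (induction n arbitrary: x)
    (use assms(1,2) in \<open>auto simp: walk_step_def intro!: add_mono mult_left_mono\<close>)

lemma walk_affine:
  "(walk_step q ^^ n) (\<lambda>x. c + d * F x) x = c + d * (walk_step q ^^ n) F x"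
  by (induction n arbitrary: x) (auto simp: walk_step_def algebra_simps)

lemma walk_add:
  "(walk_step q ^^ n) (\<lambda>x. F x + G x) x = (walk_step q ^^ n) F x + (walk_step q ^^ n) G x"
  by (induction n arbitrary: x) (auto simp: walk_step_def algebra_simps)

lemma walk_shift: "(walk_step q ^^ n) (\<lambda>x. F (s + x)) x = (walk_step q ^^ n) F (s + x)"
  by (induction n arbitrary: x) (auto simp: walk_step_def)

text \<open>
  The operator \<open>T\<close> and multiplication by the position satisfy \<open>T (X F) = X (T F) + q (F \<circ> Suc)\<close>, and
  \<open>T\<close> commutes with the shift \<open>F \<circ> Suc\<close>; so each of the \<open>n\<close> steps contributes the same extra term.
  For \<open>n = 0\<close> the truncated exponent is harmless because of the factor \<open>n\<close>.
\<close>

lemma walk_mult_position: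
  "(walk_step q ^^ n) (\<lambda>x. real x * F x) x =
     real x * (walk_step q ^^ n) F x + real n * q * (walk_step q ^^ (n - 1)) F (Suc x)"
proof (induction n arbitrary: x)
  case (Suc n)
  have "real n * (walk_step q ^^ n) F (Suc x) =
      real n * (q * (walk_step q ^^ (n - 1)) F (Suc (Suc x)) +
                (1 - q) * (walk_step q ^^ (n - 1)) F (Suc x))"
    by (cases n) (simp_all add: walk_step_def)
  then show ?case
    unfolding walk_Suc Suc.IH diff_Suc_1 of_nat_Suc by algebra
qed auto

text \<open>
  The quotient \<open>\<phi>\<close> below is the slope of the chord from \<open>0\<close>, raised by \<open>K\<close> at its far end. The
  expectation of \<open>X\<^sub>b \<phi> (X\<^bsub>a+b\<^esub>)\<close> and that of \<open>X\<^bsub>a+b\<^esub> \<phi> (X\<^bsub>a+b\<^esub>)\<close> are \<open>b\<close> times and \<open>a + b\<close> times the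
  same number \<open>D\<close>, by the size-bias identity; this is where the random weight turns into \<open>b / (a + b)\<close>.
\<close>

lemma walk_K_convex_at_0:
  assumes K: "K \<ge> 0" and f: "K_convex K f" and q: "0 \<le> q" "q \<le> 1"
  shows "real (a + b) * (walk_step q ^^ b) f 0 \<le>
           real a * f 0 + real b * (K + (walk_step q ^^ (a + b)) f 0)"
proof -
  let ?T = "\<lambda>n. walk_step q ^^ n"
  \<comment> \<open>\<open>\<phi> 0 = 0\<close> through division by zero. The factor \<open>real w\<close> kills this value where it matters, and
      \<open>0 \<le> K\<close> then gives \<open>real w * \<phi> w \<le> K + f w - f 0\<close> at \<open>w = 0\<close> as well.\<close>
  define \<phi> where "\<phi> w = (K + f w - f 0) / real w" for w
  define D where "D = q * ?T (a + b - 1) \<phi> (Suc 0)"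
  have chord: "f v \<le> f 0 + real v * \<phi> (v + d)" for v d
  proof (cases "v + d = 0")
    case False
    have "real d * (f v - f (v - v)) \<le> real v * (K + f (v + d) - f v)"
      using f unfolding K_convex_def by blast
    then have "(f v - f 0) * real (v + d) \<le> real v * (K + f (v + d) - f 0)"
      by (simp add: algebra_simps)
    with False have "f v - f 0 \<le> real v * (K + f (v + d) - f 0) / real (v + d)"
      by (subst pos_le_divide_eq) auto
    then show ?thesis
      by (simp add: \<phi>_def)
  qed auto
  have bound_b: "f v \<le> f 0 + real v * ?T a \<phi> v" for v
  proof -
    \<comment> \<open>The walk started at \<open>v\<close> has position \<open>v + d\<close> after \<open>a\<close> steps; \<open>chord\<close> is averaged over \<open>d\<close>.\<close>
    have "f v = ?T a (\<lambda>_. f v + 0 * 0) 0"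
      unfolding walk_affine by simp
    also have "\<dots> \<le> ?T a (\<lambda>d. f 0 + real v * \<phi> (v + d)) 0"
      using chord by (intro walk_mono q) auto
    also have "\<dots> = f 0 + real v * ?T a \<phi> v"
      unfolding walk_affine walk_shift by simp
    finally show ?thesis .
  qed
  have "?T b f 0 \<le> ?T b (\<lambda>v. f 0 + 1 * (real v * ?T a \<phi> v)) 0"
    using bound_b by (intro walk_mono q) auto
  also have "\<dots> = f 0 + real b * q * ?T (b - 1) (?T a \<phi>) (Suc 0)"
    unfolding walk_affine walk_mult_position by simp
  also have "\<dots> = f 0 + real b * D"
  proof (cases b)
    case (Suc b')
    then have "a + b - 1 = (b - 1) + a" by simp
    then show ?thesis by (simp add: D_def funpow_add)
  qed auto
  finally have upper: "?T b f 0 \<le> f 0 + real b * D" .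
  have "real (a + b) * D = ?T (a + b) (\<lambda>w. real w * \<phi> w) 0"
    unfolding walk_mult_position by (simp add: D_def)
  also have "\<dots> \<le> ?T (a + b) (\<lambda>w. (K - f 0) + 1 * f w) 0"
    using K by (intro walk_mono q) (auto simp: \<phi>_def)
  also have "\<dots> = K - f 0 + ?T (a + b) f 0"
    unfolding walk_affine by simp
  finally have lower: "real (a + b) * D \<le> K - f 0 + ?T (a + b) f 0" .
  have "real (a + b) * ?T b f 0 \<le> real (a + b) * (f 0 + real b * D)"
    using upper by (rule mult_left_mono) simp
  also have "\<dots> = real (a + b) * f 0 + real b * (real (a + b) * D)"
    by (simp add: algebra_simps)
  also have "\<dots> \<le> real (a + b) * f 0 + real b * (K - f 0 + ?T (a + b) f 0)"
    using lower by (intro add_left_mono mult_left_mono) auto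
  finally show ?thesis
    by (simp add: algebra_simps)
qed

lemma K_convex_shift:
  assumes "K_convex K f"
  shows "K_convex K (\<lambda>x. f (s + x))"
  unfolding K_convex_def
proof (intro allI impI)
  fix x a b :: nat
  assume "b \<le> x"
  then show "real a * (f (s + x) - f (s + (x - b))) \<le> real b * (K + f (s + (x + a)) - f (s + x))"
    using assms[unfolded K_convex_def, rule_format, of b "s + x" a] by (simp add: add.assoc)
qed

lemma K_convex_walk:
  assumes K: "K \<ge> 0" and f: "K_convex K f" and q: "0 \<le> q" "q \<le> 1"
  shows "K_convex K (\<lambda>n. (walk_step q ^^ n) f x)"
  unfolding K_convex_def
proof (intro allI impI)
  fix n a b :: nat
  assume "b \<le> n"
  define z where "z = n - b"
  have n: "n = z + b" "n + a = z + (a + b)" using \<open>b \<le> n\<close> by (auto simp: z_def)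
  let ?T = "\<lambda>n. walk_step q ^^ n"
  have from_s: "real (a + b) * ?T b f s \<le> real a * f s + real b * (K + ?T (a + b) f s)" for s
    using walk_K_convex_at_0[OF K K_convex_shift[OF f, of s] q, of a b]
    by (simp add: walk_shift)
  have "0 + real (a + b) * ?T z (?T b f) x = ?T z (\<lambda>s. 0 + real (a + b) * ?T b f s) x"
    by (rule walk_affine[symmetric])
  also have "\<dots> \<le> ?T z (\<lambda>s. (0 + real a * f s) + (real b * K + real b * ?T (a + b) f s)) x"
    using from_s by (intro walk_mono q) (simp add: algebra_simps)
  also have "\<dots> = real a * ?T z f x + (real b * K + real b * ?T z (?T (a + b) f) x)"
    by (subst walk_add, subst walk_affine, subst walk_affine) simp
  finally have "real (a + b) * ?T n f x \<le>
      real a * ?T (n - b) f x + (real b * K + real b * ?T (n + a) f x)"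
    by (simp only: n(2) funpow_add[of z] z_def[symmetric] o_apply add_0)
      (simp only: n(1) funpow_add o_apply)
  then show "real a * (?T n f x - ?T (n - b) f x) \<le> real b * (K + ?T (n + a) f x - ?T n f x)"
    by (simp add: algebra_simps)
qed

text \<open>
  A failure of the binomial experiment with success probability \<open>p\<close> is an upward step of the walk
  with parameter \<open>1 - p\<close>; splitting off one Bernoulli trial gives the recursion of \<open>walk_step\<close>.
\<close>

lemma expectation_binomial_failures:
  assumes p: "p \<in> {0..1}"
  shows "measure_pmf.expectation (binomial_pmf n p) (\<lambda>k. F (x + (n - k))) = (walk_step (1 - p) ^^ n) F x"
proof (induction n arbitrary: x)
  case 0
  then show ?case using p by (simp add: binomial_pmf_0)
next
  case (Suc n)
  let ?B = "binomial_pmf n p"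
  have le: "AE k in ?B. k \<le> n"
    using p by (auto simp: AE_measure_pmf_iff set_pmf_binomial_eq split: if_splits)
  have "measure_pmf.expectation (binomial_pmf (Suc n) p) (\<lambda>k. F (x + (Suc n - k))) =
      p * measure_pmf.expectation ?B (\<lambda>k. F (x + (n - k))) +
      (1 - p) * measure_pmf.expectation ?B (\<lambda>k. F (x + (Suc n - k)))"
    using p by (subst binomial_pmf_Suc, simp, subst pmf_expectation_bind[where A = UNIV])
      (auto simp: UNIV_bool map_pmf_def[symmetric] intro!: finite_imageI finite_set_pmf_binomial_pmf)
  also have "measure_pmf.expectation ?B (\<lambda>k. F (x + (Suc n - k))) =
      measure_pmf.expectation ?B (\<lambda>k. F (Suc x + (n - k)))"
    using le by (intro integral_cong_AE) (auto elim!: eventually_mono simp: Suc_diff_le)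
  finally show ?case
    by (simp only: Suc.IH) (simp add: walk_step_def)
qed

theorem lemma3:
  fixes K p :: real
    and f :: "nat \<Rightarrow> real"
    and M :: "'a measure"
    and \<omega> :: "nat \<Rightarrow> 'a \<Rightarrow> nat"
  assumes "K \<ge> 0"
    and "K_convex K f"
    and "p \<in> {0..1}"
    and "prob_space M"
    and "\<And>y. \<omega> y \<in> M \<rightarrow>\<^sub>M count_space UNIV"
    and "\<And>y. distr M (count_space UNIV) (\<omega> y) = measure_pmf (binomial_pmf y p)"
    and "\<And>y. integrable M (\<lambda>s. \<bar>f (y - \<omega> y s)\<bar>)"
  shows "K_convex K (\<lambda>y. \<integral>s. f (y - \<omega> y s) \<partial>M)"
proof -
  have "(\<integral>s. f (y - \<omega> y s) \<partial>M) = (walk_step (1 - p) ^^ y) f 0" for y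
  proof -
    have "(\<integral>s. f (y - \<omega> y s) \<partial>M) = (\<integral>k. f (y - k) \<partial>distr M (count_space UNIV) (\<omega> y))"
      using assms(5) by (simp add: integral_distr)
    also have "\<dots> = (walk_step (1 - p) ^^ y) f 0"
      unfolding assms(6) using expectation_binomial_failures[OF assms(3), of y f 0] by simp
    finally show ?thesis .
  qed
  then show ?thesis
    using K_convex_walk[OF assms(1,2), of "1 - p" 0] assms(3) by simp
qed

end
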